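(* Let $W$ be a finite Coxeter group and let $x\neq 0$ be a real number. Then $M_{W,x}$ is a signed probability measure on $W$, i.e. $\sum_{w\in W} M_{W,x}(w)=1$.
   Context: $W$ is a finite Coxeter group of rank $n$ acting on its $n$-dimensional real reflection representation $V$, with (reduced, $W$-stable) root system $\Phi$ and base $\Pi$ of simple roots. For $w\in W$, $Des(w)=\{\alpha\in\Pi : w(\alpha)\text{ is a negative root}\}$. For $J\subseteq\Pi$ let $X_J=\{w\in W: Des(w)\cap J=\emptyset\}$ and $x_J=\sum_{w\in X_J}w\in\mathbb{Q}[W]$. On subsets of $\Pi$ put $J\sim K$ iff $w(J)=K$ for some $w\in W$; $\lambda$ denotes an equivalence class, $\lambda(K)$ the class of $K$, $|\lambda|$ the number of subsets in $\lambda$, and $\|\lambda\|=|J|$ for any $J\in\lambda$. For $K\subseteq J\subseteq\Pi$ let $\mu_K^J=\frac{|\{w\in X_J: w(K)\subseteq\Pi\}|}{|\lambda(K)|}$, and $\mu_K^J=0$ if $K\not\subseteq J$. Let $(\beta_K^J)$ be the inverse of the matrix $(\mu_K^J)$ (rows indexed by $J$, columns by $K$). Define $e_\lambda=\frac{1}{|\lambda|}\sum_{J\in\lambda}\sum_{K\subseteq J}\beta_K^J x_K$. (It is known, by Bergeron–Bergeron–Howlett–Taylor, that the $e_\lambda$ are orthogonal idempotents of the group algebra summing to the identity.) For real $x\ne0$ define $M_{W,x}=\sum_\lambda \frac{e_\lambda}{x^{\|\lambda\|}}$ in the group algebra $\mathbb{R}[W]$, and let $M_{W,x}(w)$ be the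 coefficient of $w$ in $M_{W,x}$. A signed probability measure on $W$ is a real-valued function on $W$ (possibly taking negative values) whose values sum to $1$. *)

theory Defs
  imports "HOL-Analysis.Inner_Product" "HOL-Algebra.Group_Action"
begin

section \<open>Coxeter systems\<close>

text \<open>
  A Coxeter system is defined by its presentation: \<open>S\<close> generates the group, and all relations
  between words in \<open>S\<close> are consequences of \<open>(s t)\<^bsup>m(s,t)\<^esup> = 1\<close>. The entry \<open>0\<close> of a Coxeter matrix
  stands for \<open>\<infinity>\<close> (it yields the trivial relation). Since \<open>m(s,s) = 1\<close> makes
  \<open>s s = 1\<close> a relation, no formal inverses of letters are needed.
\<close>

definition coxeter_matrix :: "'g set \<Rightarrow> ('g \<Rightarrow> 'g \<Rightarrow> nat) \<Rightarrow> bool" where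
  "coxeter_matrix S m \<longleftrightarrow>
     (\<forall>s\<in>S. m s s = 1) \<and> (\<forall>s\<in>S. \<forall>t\<in>S. s \<noteq> t \<longrightarrow> m s t = m t s \<and> m s t \<noteq> 1)"

inductive coxeter_word_eq :: "'g set \<Rightarrow> ('g \<Rightarrow> 'g \<Rightarrow> nat) \<Rightarrow> 'g list \<Rightarrow> 'g list \<Rightarrow> bool"
  for S m where
  refl: "us \<in> lists S \<Longrightarrow> coxeter_word_eq S m us us"
| sym: "coxeter_word_eq S m us vs \<Longrightarrow> coxeter_word_eq S m vs us"
| trans: "coxeter_word_eq S m us vs \<Longrightarrow> coxeter_word_eq S m vs ws \<Longrightarrow> coxeter_word_eq S m us ws"
| relator: "us \<in> lists S \<Longrightarrow> vs \<in> lists S \<Longrightarrow> s \<in> S \<Longrightarrow> t \<in> S \<Longrightarrow>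
    coxeter_word_eq S m (us @ concat (replicate (m s t) [s, t]) @ vs) (us @ vs)"

definition word_prod :: "('g, 'c) monoid_scheme \<Rightarrow> 'g list \<Rightarrow> 'g" where
  "word_prod W ws = foldr (mult W) ws \<one>\<^bsub>W\<^esub>"

definition coxeter_system :: "('g, 'c) monoid_scheme \<Rightarrow> 'g set \<Rightarrow> bool" where
  "coxeter_system W S \<longleftrightarrow>
     group W \<and> S \<subseteq> carrier W \<and>
     (\<exists>m. coxeter_matrix S m \<and>
        carrier W = word_prod W ` lists S \<and>
        (\<forall>us\<in>lists S. \<forall>vs\<in>lists S.
           word_prod W us = word_prod W vs \<longleftrightarrow> coxeter_word_eq S m us vs))"


section \<open>Root systems and the reflection representation\<close>

definition root_reflection :: "'v::real_inner \<Rightarrow> 'v \<Rightarrow> 'v" where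
  "root_reflection \<alpha> v = v - (2 * inner v \<alpha> / inner \<alpha> \<alpha>) *\<^sub>R \<alpha>"

text \<open>Not assumed crystallographic; roots need not have the same length.\<close>

definition root_system :: "'v::real_inner set \<Rightarrow> 'v set \<Rightarrow> bool" where
  "root_system V \<Phi> \<longleftrightarrow>
     finite \<Phi> \<and> 0 \<notin> \<Phi> \<and> span \<Phi> = V \<and>
     (\<forall>\<alpha>\<in>\<Phi>. \<Phi> \<inter> span {\<alpha>} = {\<alpha>, - \<alpha>}) \<and>
     (\<forall>\<alpha>\<in>\<Phi>. root_reflection \<alpha> ` \<Phi> = \<Phi>)"

definition positive_roots :: "'v::real_inner set \<Rightarrow> 'v set \<Rightarrow> 'v set" where
  "positive_roots \<Phi> \<Delta> =
     {\<gamma> \<in> \<Phi>. \<exists>c. (\<forall>\<alpha>\<in>\<Delta>. c \<alpha> \<ge> (0::real)) \<and> \<gamma> = (\<Sum>\<alpha>\<in>\<Delta>. c \<alpha> *\<^sub>R \<alpha>)}"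

definition negative_roots :: "'v::real_inner set \<Rightarrow> 'v set \<Rightarrow> 'v set" where
  "negative_roots \<Phi> \<Delta> =
     {\<gamma> \<in> \<Phi>. \<exists>c. (\<forall>\<alpha>\<in>\<Delta>. c \<alpha> \<le> (0::real)) \<and> \<gamma> = (\<Sum>\<alpha>\<in>\<Delta>. c \<alpha> *\<^sub>R \<alpha>)}"

definition root_base :: "'v::real_inner set \<Rightarrow> 'v set \<Rightarrow> bool" where
  "root_base \<Phi> \<Delta> \<longleftrightarrow>
     \<Delta> \<subseteq> \<Phi> \<and> independent \<Delta> \<and> \<Phi> = positive_roots \<Phi> \<Delta> \<union> negative_roots \<Phi> \<Delta>"

definition linear_action :: "('g, 'c) monoid_scheme \<Rightarrow> 'v::real_vector set \<Rightarrow> ('g \<Rightarrow> 'v \<Rightarrow> 'v) \<Rightarrow> bool"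
  where "linear_action W V \<phi> \<longleftrightarrow>
     faithful_action W V \<phi> \<and> subspace V \<and>
     (\<forall>w\<in>carrier W. \<forall>u\<in>V. \<forall>v\<in>V. \<phi> w (u + v) = \<phi> w u + \<phi> w v) \<and>
     (\<forall>w\<in>carrier W. \<forall>a. \<forall>v\<in>V. \<phi> w (a *\<^sub>R v) = a *\<^sub>R \<phi> w v)"

text \<open>
  The last clause says that the generators act on \<open>V\<close> exactly as the reflections in the simple
  roots. It gives a bijection between \<open>S\<close> and \<open>\<Delta>\<close> because the action is faithful, so the rank
  \<open>card S\<close> equals \<open>card \<Delta> = dim V\<close>, and \<open>\<Phi>\<close> is stable under \<open>W\<close>.
  The space \<open>V\<close> is a subspace of the ambient type so that rank \<open>0\<close> is included.
\<close>

definition coxeter_realization ::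
  "('g, 'c) monoid_scheme \<Rightarrow> 'g set \<Rightarrow> 'v::real_inner set \<Rightarrow> ('g \<Rightarrow> 'v \<Rightarrow> 'v) \<Rightarrow> 'v set \<Rightarrow> 'v set \<Rightarrow> bool"
  where "coxeter_realization W S V \<phi> \<Phi> \<Delta> \<longleftrightarrow>
     linear_action W V \<phi> \<and> root_system V \<Phi> \<and> root_base \<Phi> \<Delta> \<and>
     \<phi> ` S = (\<lambda>\<alpha>. restrict (root_reflection \<alpha>) V) ` \<Delta>"


section \<open>Descents and parabolic classes\<close>

definition descents ::
  "('g \<Rightarrow> 'v \<Rightarrow> 'v::real_inner) \<Rightarrow> 'v set \<Rightarrow> 'v set \<Rightarrow> 'g \<Rightarrow> 'v set" where
  "descents \<phi> \<Phi> \<Delta> w = {\<alpha> \<in> \<Delta>. \<phi> w \<alpha> \<in> negative_roots \<Phi> \<Delta>}"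

definition no_descents_in ::
  "('g, 'c) monoid_scheme \<Rightarrow> ('g \<Rightarrow> 'v \<Rightarrow> 'v::real_inner) \<Rightarrow> 'v set \<Rightarrow> 'v set \<Rightarrow> 'v set \<Rightarrow> 'g set" where
  "no_descents_in W \<phi> \<Phi> \<Delta> J = {w \<in> carrier W. descents \<phi> \<Phi> \<Delta> w \<inter> J = {}}"

definition subset_conj ::
  "('g, 'c) monoid_scheme \<Rightarrow> ('g \<Rightarrow> 'v \<Rightarrow> 'v) \<Rightarrow> 'v set \<Rightarrow> ('v set \<times> 'v set) set" where
  "subset_conj W \<phi> \<Delta> = {(J, K). J \<subseteq> \<Delta> \<and> K \<subseteq> \<Delta> \<and> (\<exists>w\<in>carrier W. \<phi> w ` J = K)}"

definition subset_classes ::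
  "('g, 'c) monoid_scheme \<Rightarrow> ('g \<Rightarrow> 'v \<Rightarrow> 'v) \<Rightarrow> 'v set \<Rightarrow> 'v set set set" where
  "subset_classes W \<phi> \<Delta> = Pow \<Delta> // subset_conj W \<phi> \<Delta>"

definition subset_class ::
  "('g, 'c) monoid_scheme \<Rightarrow> ('g \<Rightarrow> 'v \<Rightarrow> 'v) \<Rightarrow> 'v set \<Rightarrow> 'v set \<Rightarrow> 'v set set" where
  "subset_class W \<phi> \<Delta> K = subset_conj W \<phi> \<Delta> `` {K}"

text \<open>All members of a class have the same cardinality, so the image below is a singleton.\<close>

definition class_rank :: "'v set set \<Rightarrow> nat" where
  "class_rank \<Lambda> = the_elem (card ` \<Lambda>)"


section \<open>The group algebra elements\<close>

text \<open>
  An element of the real group algebra of \<open>W\<close> is represented by its coefficient function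
  \<open>'g \<Rightarrow> real\<close>, which vanishes outside \<open>carrier W\<close>.
\<close>

definition x_elt ::
  "('g, 'c) monoid_scheme \<Rightarrow> ('g \<Rightarrow> 'v \<Rightarrow> 'v::real_inner) \<Rightarrow> 'v set \<Rightarrow> 'v set \<Rightarrow> 'v set \<Rightarrow> 'g \<Rightarrow> real" where
  "x_elt W \<phi> \<Phi> \<Delta> J w = (if w \<in> no_descents_in W \<phi> \<Phi> \<Delta> J then 1 else 0)"

definition mu ::
  "('g, 'c) monoid_scheme \<Rightarrow> ('g \<Rightarrow> 'v \<Rightarrow> 'v::real_inner) \<Rightarrow> 'v set \<Rightarrow> 'v set \<Rightarrow> 'v set \<Rightarrow> 'v set \<Rightarrow> real" where
  "mu W \<phi> \<Phi> \<Delta> J K =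
     (if K \<subseteq> J
      then real (card {w \<in> no_descents_in W \<phi> \<Phi> \<Delta> J. \<phi> w ` K \<subseteq> \<Delta>})
             / real (card (subset_class W \<phi> \<Delta> K))
      else 0)"

text \<open>
  The inverse of a square matrix indexed by a finite set \<open>I\<close>; entries outside \<open>I \<times> I\<close> are
  normalised to \<open>0\<close>, which makes the inverse unique as a function when it exists.
\<close>

definition matrix_inv_on :: "'i set \<Rightarrow> ('i \<Rightarrow> 'i \<Rightarrow> real) \<Rightarrow> 'i \<Rightarrow> 'i \<Rightarrow> real" where
  "matrix_inv_on I A = (THE B.
     (\<forall>i\<in>I. \<forall>k\<in>I. (\<Sum>j\<in>I. A i j * B j k) = (if i = k then 1 else 0)) \<and>
     (\<forall>i\<in>I. \<forall>k\<in>I. (\<Sum>j\<in>I. B i j * A j k) = (if i = k then 1 else 0)) \<and>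
     (\<forall>i j. i \<notin> I \<or> j \<notin> I \<longrightarrow> B i j = 0))"

definition beta ::
  "('g, 'c) monoid_scheme \<Rightarrow> ('g \<Rightarrow> 'v \<Rightarrow> 'v::real_inner) \<Rightarrow> 'v set \<Rightarrow> 'v set \<Rightarrow> 'v set \<Rightarrow> 'v set \<Rightarrow> real" where
  "beta W \<phi> \<Phi> \<Delta> = matrix_inv_on (Pow \<Delta>) (mu W \<phi> \<Phi> \<Delta>)"

definition e_elt ::
  "('g, 'c) monoid_scheme \<Rightarrow> ('g \<Rightarrow> 'v \<Rightarrow> 'v::real_inner) \<Rightarrow> 'v set \<Rightarrow> 'v set \<Rightarrow> 'v set set \<Rightarrow> 'g \<Rightarrow> real" where
  "e_elt W \<phi> \<Phi> \<Delta> \<Lambda> w =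
     1 / real (card \<Lambda>) *
       (\<Sum>J\<in>\<Lambda>. \<Sum>K\<in>Pow J. beta W \<phi> \<Phi> \<Delta> J K * x_elt W \<phi> \<Phi> \<Delta> K w)"

definition M_elt ::
  "('g, 'c) monoid_scheme \<Rightarrow> ('g \<Rightarrow> 'v \<Rightarrow> 'v::real_inner) \<Rightarrow> 'v set \<Rightarrow> 'v set \<Rightarrow> real \<Rightarrow> 'g \<Rightarrow> real" where
  "M_elt W \<phi> \<Phi> \<Delta> x w =
     (\<Sum>\<Lambda>\<in>subset_classes W \<phi> \<Delta>. e_elt W \<phi> \<Phi> \<Delta> \<Lambda> w / x ^ class_rank \<Lambda>)"

definition signed_probability_measure :: "'g set \<Rightarrow> ('g \<Rightarrow> real) \<Rightarrow> bool" where
  "signed_probability_measure A f \<longleftrightarrow> (\<Sum>w\<in>A. f w) = 1"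

end

theory Submission
  imports Defs
begin

text \<open>
  Applying the augmentation map (sum of coefficients) to \<open>x\<^sub>K\<close> gives \<open>|X\<^sub>K|\<close>, which is exactly the
  matrix entry of \<open>\<mu>\<close> in row \<open>K\<close> and column \<open>\<emptyset>\<close>. Hence the augmentation of
  \<open>\<Sum>\<^sub>K \<beta>\<^sup>J\<^sub>K x\<^sub>K\<close> is the \<open>(J, \<emptyset>)\<close> entry of \<open>\<beta> \<mu> = 1\<close>, so only the class of \<open>\<emptyset>\<close>, which has
  rank \<open>0\<close>, contributes to the total mass. The matrix \<open>\<mu>\<close> is invertible with inverse supported on
  pairs \<open>K \<subseteq> J\<close> because it is triangular for inclusion with nonzero diagonal.
\<close>

section \<open>Triangular matrices over a finite partial order\<close>

text \<open>Forward substitution: a row of the inverse is built from the rows at smaller indices, so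
  the induction runs on the number of elements of \<open>I\<close> strictly below
  \<open>i\<close>.\<close>

lemma triangular_left_inverse_row:
  fixes A :: "'i::order \<Rightarrow> 'i \<Rightarrow> real"
  assumes fin: "finite I" and tri: "\<And>i j. \<not> j \<le> i \<Longrightarrow> A i j = 0"
    and diag: "\<And>i. i \<in> I \<Longrightarrow> A i i \<noteq> 0" and "i \<in> I"
  shows "\<exists>b. (\<forall>j. j \<notin> I \<or> \<not> j \<le> i \<longrightarrow> b j = 0) \<and>
    (\<forall>k\<in>I. (\<Sum>j\<in>I. b j * A j k) = (if i = k then 1 else 0))"
  using \<open>i \<in> I\<close>
proof (induction "card {j \<in> I. j < i}" arbitrary: i rule: less_induct)
  case (less i)
  let ?D = "{j \<in> I. j < i}"
  have "\<exists>b. (\<forall>j. j \<notin> I \<or> \<not> j \<le> l \<longrightarrow> b j = 0) \<and>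
    (\<forall>k\<in>I. (\<Sum>j\<in>I. b j * A j k) = (if l = k then 1 else 0))" if "l \<in> ?D" for l
  proof (rule less.hyps)
    show "card {j \<in> I. j < l} < card ?D"
      using that fin by (intro psubset_card_mono) auto
  qed (use that in auto)
  then have "\<exists>b. \<forall>l\<in>?D. (\<forall>j. j \<notin> I \<or> \<not> j \<le> l \<longrightarrow> b l j = 0) \<and>
    (\<forall>k\<in>I. (\<Sum>j\<in>I. b l j * A j k) = (if l = k then 1 else 0))"
    by (intro bchoice ballI)
  then obtain b where b: "\<And>l j. l \<in> ?D \<Longrightarrow> j \<notin> I \<or> \<not> j \<le> l \<Longrightarrow> b l j = 0"
    "\<And>l k. l \<in> ?D \<Longrightarrow> k \<in> I \<Longrightarrow> (\<Sum>j\<in>I. b l j * A j k) = (if l = k then 1 else 0)"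
    by blast
  \<comment> \<open>This is row \<open>i\<close> of \<open>AB = 1\<close> solved for the unknown row
    \<open>c\<close> of \<open>B\<close>. Multiplied by \<open>A\<close>, it yields row
    \<open>i\<close> of \<open>A\<close> minus the strictly lower part of that row.\<close>
  define c where "c j = ((if j = i then 1 else 0) - (\<Sum>l\<in>?D. A i l * b l j)) / A i i" for j
  have "c j = 0" if "j \<notin> I \<or> \<not> j \<le> i" for j
  proof -
    have "(\<Sum>l\<in>?D. A i l * b l j) = 0"
    proof (intro sum.neutral ballI)
      fix l assume l: "l \<in> ?D"
      then have "j \<notin> I \<or> \<not> j \<le> l" using that by auto
      then show "A i l * b l j = 0" using b(1)[OF l] by simp
    qed
    then show ?thesis using that less.prems by (auto simp: c_def)
  qed
  moreover have "(\<Sum>j\<in>I. c j * A j k) = (if i = k then 1 else 0)" if k: "k \<in> I" for k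
  proof -
    have "A i i * (\<Sum>j\<in>I. c j * A j k)
        = (\<Sum>j\<in>I. (if j = i then A j k else 0) - (\<Sum>l\<in>?D. A i l * (b l j * A j k)))"
      unfolding sum_distrib_left
    proof (rule sum.cong)
      fix j
      have "A i i * c j = (if j = i then 1 else 0) - (\<Sum>l\<in>?D. A i l * b l j)"
        using diag[OF less.prems] by (simp add: c_def)
      then have "A i i * (c j * A j k)
          = ((if j = i then 1 else 0) - (\<Sum>l\<in>?D. A i l * b l j)) * A j k"
        by (simp only: mult.assoc[symmetric])
      then show "A i i * (c j * A j k)
          = (if j = i then A j k else 0) - (\<Sum>l\<in>?D. A i l * (b l j * A j k))"
        by (simp add: left_diff_distrib sum_distrib_right mult.assoc)
    qed simp
    also have "\<dots> = A i k - (\<Sum>l\<in>?D. A i l * (\<Sum>j\<in>I. b l j * A j k))"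
      unfolding sum_subtractf sum_distrib_left sum.swap[of _ ?D I]
      using fin less.prems by simp
    also have "(\<Sum>l\<in>?D. A i l * (\<Sum>j\<in>I. b l j * A j k)) = (\<Sum>l\<in>?D. if l = k then A i l else 0)"
      by (rule sum.cong) (use b(2) k in auto)
    also have "\<dots> = (if k < i then A i k else 0)"
      using fin k by simp
    \<comment> \<open>The entries with \<open>k < i\<close> have cancelled and \<open>tri\<close>
      removes those with \<open>k\<close> not below \<open>i\<close>, so only the diagonal entry is
      left.\<close>
    also have "A i k - \<dots> = (if i = k then A i i else 0)"
      using tri[of k i] by (auto simp: order_le_less)
    finally show ?thesis using diag[OF less.prems] by (auto split: if_splits)
  qed
  ultimately show ?case by blast
qed

text \<open>The support condition makes \<open>B\<close> triangular again, so the lemma can later be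
  applied to \<open>B\<close> itself; it also supplies the normalisation in
  \<open>matrix_inv_on\<close>.\<close>

lemma triangular_left_inverse:
  fixes A :: "'i::order \<Rightarrow> 'i \<Rightarrow> real"
  assumes "finite I" and "\<And>i j. \<not> j \<le> i \<Longrightarrow> A i j = 0" and "\<And>i. i \<in> I \<Longrightarrow> A i i \<noteq> 0"
  obtains B where "\<And>i j. i \<notin> I \<or> j \<notin> I \<or> \<not> j \<le> i \<Longrightarrow> B i j = 0"
    and "\<And>i k. i \<in> I \<Longrightarrow> k \<in> I \<Longrightarrow> (\<Sum>j\<in>I. B i j * A j k) = (if i = k then 1 else 0)"
proof -
  have "\<exists>b. \<forall>i\<in>I. (\<forall>j. j \<notin> I \<or> \<not> j \<le> i \<longrightarrow> b i j = 0) \<and>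
    (\<forall>k\<in>I. (\<Sum>j\<in>I. b i j * A j k) = (if i = k then 1 else 0))"
    using triangular_left_inverse_row[of I A] assms by (intro bchoice ballI) blast
  then obtain b where b: "\<And>i j. i \<in> I \<Longrightarrow> j \<notin> I \<or> \<not> j \<le> i \<Longrightarrow> b i j = 0"
    "\<And>i k. i \<in> I \<Longrightarrow> k \<in> I \<Longrightarrow> (\<Sum>j\<in>I. b i j * A j k) = (if i = k then 1 else 0)"
    by blast
  show thesis
    by (rule that[of "\<lambda>i j. if i \<in> I then b i j else 0"]) (use b in auto)
qed

text \<open>The monoid argument \<open>B = B(AC) = (BA)C = C\<close>, with all products restricted
  to \<open>I\<close>.\<close>

lemma left_right_inverse_unique:
  fixes A B C :: "'i \<Rightarrow> 'i \<Rightarrow> real"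
  assumes "finite I" "i \<in> I" "k \<in> I"
    and BA: "\<And>i k. i \<in> I \<Longrightarrow> k \<in> I \<Longrightarrow> (\<Sum>j\<in>I. B i j * A j k) = (if i = k then 1 else 0)"
    and AC: "\<And>i k. i \<in> I \<Longrightarrow> k \<in> I \<Longrightarrow> (\<Sum>j\<in>I. A i j * C j k) = (if i = k then 1 else 0)"
  shows "B i k = C i k"
proof -
  have "B i k = (\<Sum>j\<in>I. if j = k then B i j else 0)"
    using assms(1,3) by simp
  also have "\<dots> = (\<Sum>j\<in>I. B i j * (\<Sum>l\<in>I. A j l * C l k))"
    by (rule sum.cong) (use AC assms(3) in auto)
  also have "\<dots> = (\<Sum>l\<in>I. \<Sum>j\<in>I. B i j * (A j l * C l k))"
    unfolding sum_distrib_left by (rule sum.swap)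
  also have "\<dots> = (\<Sum>l\<in>I. (\<Sum>j\<in>I. B i j * A j l) * C l k)"
    by (simp add: sum_distrib_right mult.assoc)
  also have "\<dots> = (\<Sum>l\<in>I. if i = l then C l k else 0)"
    by (rule sum.cong) (use BA assms(2) in auto)
  also have "\<dots> = C i k"
    using assms(1,2) by simp
  finally show ?thesis .
qed

text \<open>The triangular left inverse \<open>B\<close> of \<open>A\<close> has a left inverse
  \<open>C\<close> of its own. Since \<open>A\<close> is a right inverse of \<open>B\<close>,
  \<open>C\<close> equals \<open>A\<close> on \<open>I\<close>, which makes \<open>B\<close> a
  two-sided inverse.\<close>

lemma matrix_inv_on_triangular:
  fixes A :: "'i::order \<Rightarrow> 'i \<Rightarrow> real"
  assumes fin: "finite I" and tri: "\<And>i j. \<not> j \<le> i \<Longrightarrow> A i j = 0"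
    and diag: "\<And>i. i \<in> I \<Longrightarrow> A i i \<noteq> 0"
  shows "\<And>i k. i \<in> I \<Longrightarrow> k \<in> I \<Longrightarrow>
      (\<Sum>j\<in>I. matrix_inv_on I A i j * A j k) = (if i = k then 1 else 0)"
    and "\<And>i j. \<not> j \<le> i \<Longrightarrow> matrix_inv_on I A i j = 0"
proof -
  obtain B where B: "\<And>i j. i \<notin> I \<or> j \<notin> I \<or> \<not> j \<le> i \<Longrightarrow> B i j = 0"
    "\<And>i k. i \<in> I \<Longrightarrow> k \<in> I \<Longrightarrow> (\<Sum>j\<in>I. B i j * A j k) = (if i = k then 1 else 0)"
    using triangular_left_inverse[of I A, OF fin tri diag] by blast
  \<comment> \<open>By antisymmetry only \<open>j = i\<close> contributes to the diagonal entry of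
    \<open>BA\<close>, so \<open>B i i * A i i = 1\<close>.\<close>
  have B_diag: "B i i \<noteq> 0" if "i \<in> I" for i
  proof
    assume "B i i = 0"
    then have "B i j * A j i = 0" for j
      using B(1)[of i j] tri[of i j] by (cases "j = i") (auto dest: antisym)
    then have "(\<Sum>j\<in>I. B i j * A j i) = 0"
      by (simp only: sum.neutral_const)
    then show False using B(2)[OF that that] by simp
  qed
  obtain C where C:
    "\<And>i k. i \<in> I \<Longrightarrow> k \<in> I \<Longrightarrow> (\<Sum>j\<in>I. C i j * B j k) = (if i = k then 1 else 0)"
    by (rule triangular_left_inverse[of I B]) (use fin B(1) B_diag in auto)
  have AB: "(\<Sum>j\<in>I. A i j * B j k) = (if i = k then 1 else 0)" if "i \<in> I" "k \<in> I" for i k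
  proof -
    have "(\<Sum>j\<in>I. A i j * B j k) = (\<Sum>j\<in>I. C i j * B j k)"
      by (rule sum.cong[OF HOL.refl]) (simp add: left_right_inverse_unique[OF fin that(1) _ C B(2)])
    then show ?thesis using C that by simp
  qed
  have inv: "matrix_inv_on I A = B"
    unfolding matrix_inv_on_def
  proof (rule the_equality)
    fix B'
    assume B': "(\<forall>i\<in>I. \<forall>k\<in>I. (\<Sum>j\<in>I. A i j * B' j k) = (if i = k then 1 else 0)) \<and>
      (\<forall>i\<in>I. \<forall>k\<in>I. (\<Sum>j\<in>I. B' i j * A j k) = (if i = k then 1 else 0)) \<and>
      (\<forall>i j. i \<notin> I \<or> j \<notin> I \<longrightarrow> B' i j = 0)"
    show "B' = B"
    proof (intro ext)
      fix i k
      show "B' i k = B i k"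
      proof (cases "i \<in> I \<and> k \<in> I")
        case True
        then show ?thesis
          \<comment> \<open>\<open>B'\<close> is a left and \<open>B\<close> a right inverse of
            \<open>A\<close>; outside \<open>I\<close> both are zero by normalisation.\<close>
          by (intro left_right_inverse_unique[OF fin, of i k B' A B]) (simp_all add: B' AB)
      qed (use B(1) B' in auto)
    qed
  qed (use AB B in auto)
  show "\<And>i k. i \<in> I \<Longrightarrow> k \<in> I \<Longrightarrow>
      (\<Sum>j\<in>I. matrix_inv_on I A i j * A j k) = (if i = k then 1 else 0)"
    and "\<And>i j. \<not> j \<le> i \<Longrightarrow> matrix_inv_on I A i j = 0"
    unfolding inv by (use B(2) in blast, use B(1) in blast)
qed


section \<open>The total mass\<close>

lemma base_root_not_negative:
  assumes "root_base \<Phi> \<Delta>" "finite \<Delta>" "\<alpha> \<in> \<Delta>"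
  shows "\<alpha> \<notin> negative_roots \<Phi> \<Delta>"
proof
  assume "\<alpha> \<in> negative_roots \<Phi> \<Delta>"
  then obtain c where c: "\<forall>\<beta>\<in>\<Delta>. c \<beta> \<le> (0::real)" "\<alpha> = (\<Sum>\<beta>\<in>\<Delta>. c \<beta> *\<^sub>R \<beta>)"
    by (auto simp: negative_roots_def)
  \<comment> \<open>Moving \<alpha> to the other side gives a linear relation on the base;
    independence forces \<open>c \<alpha> = 1\<close>, against
    \<open>c \<alpha> \<le> 0\<close>.\<close>
  have "(\<Sum>\<beta>\<in>\<Delta>. (c \<beta> - (if \<beta> = \<alpha> then 1 else 0)) *\<^sub>R \<beta>)
      = (\<Sum>\<beta>\<in>\<Delta>. c \<beta> *\<^sub>R \<beta>) - (\<Sum>\<beta>\<in>\<Delta>. if \<beta> = \<alpha> then \<beta> else 0)"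
    unfolding sum_subtractf[symmetric] by (rule sum.cong) (auto simp: algebra_simps)
  also have "\<dots> = 0"
    using assms(2,3) c(2) by simp
  finally have sum0: "(\<Sum>\<beta>\<in>\<Delta>. (c \<beta> - (if \<beta> = \<alpha> then 1 else 0)) *\<^sub>R \<beta>) = 0" .
  have "c \<alpha> - (if \<alpha> = \<alpha> then 1 else 0) = 0"
    using assms(1) independentD[OF _ assms(2) subset_refl sum0 assms(3)]
    by (simp add: root_base_def)
  then show False using c(1) assms(3) by force
qed

text \<open>The identity is counted in the numerator and \<open>J\<close> lies in its own class;
  both sets are finite, so both cardinalities are positive.\<close>

lemma mu_diagonal_nonzero:
  assumes "group W" "finite (carrier W)" "coxeter_realization W S V \<phi> \<Phi> \<Delta>" "finite \<Delta>" "J \<subseteq> \<Delta>"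
  shows "mu W \<phi> \<Phi> \<Delta> J J \<noteq> 0"
proof -
  interpret group W by fact
  have act: "group_action W V \<phi>" and base: "root_base \<Phi> \<Delta>" and span: "span \<Phi> = V"
    using assms(3) by (auto simp: coxeter_realization_def linear_action_def faithful_action_def
        root_system_def)
  have "\<Delta> \<subseteq> V"
    using base span span_superset[of \<Phi>] by (auto simp: root_base_def)
  \<comment> \<open>The identity of \<open>W\<close> acts as the identity map restricted to
    \<open>V\<close>, so membership of the simple roots in \<open>V\<close> matters.\<close>
  then have one: "\<phi> \<one>\<^bsub>W\<^esub> \<alpha> = \<alpha>" if "\<alpha> \<in> \<Delta>" for \<alpha>
    using group_action.id_eq_one[OF act] that by (metis restrict_apply' subsetD)
  have "\<one>\<^bsub>W\<^esub> \<in> {w \<in> no_descents_in W \<phi> \<Phi> \<Delta> J. \<phi> w ` J \<subseteq> \<Delta>}"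
    using one base_root_not_negative[OF base assms(4)] assms(5)
    by (auto simp: no_descents_in_def descents_def subset_iff)
  moreover have "finite {w \<in> no_descents_in W \<phi> \<Phi> \<Delta> J. \<phi> w ` J \<subseteq> \<Delta>}"
    using assms(2) by (rule rev_finite_subset) (auto simp: no_descents_in_def)
  moreover have "\<phi> \<one>\<^bsub>W\<^esub> ` J = J"
    using one assms(5) by (force simp: subset_iff)
  then have "J \<in> subset_class W \<phi> \<Delta> J"
    using assms(5) by (auto simp: subset_class_def subset_conj_def)
  moreover have "finite (subset_class W \<phi> \<Delta> J)"
    using assms(4)
    by (rule finite_subset[rotated, OF finite_Pow_iff[THEN iffD2]])
      (auto simp: subset_class_def subset_conj_def)
  ultimately show ?thesis
    by (auto simp: mu_def)
qed

section \<open>Augmentation of \<open>x_elt\<close> and \<open>e_elt\<close>\<close>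

lemma subset_class_empty:
  assumes "group W"
  shows "subset_class W \<phi> \<Delta> {} = {{}}"
  using group.subgroup_self[OF assms] subgroup.one_closed[of "carrier W" W]
  by (auto simp: subset_class_def subset_conj_def)

text \<open>In the column of \<open>{}\<close> the condition on images is vacuous and the
  denominator is 1.\<close>

lemma sum_x_elt:
  assumes "group W" "finite (carrier W)"
  shows "(\<Sum>w\<in>carrier W. x_elt W \<phi> \<Phi> \<Delta> K w) = mu W \<phi> \<Phi> \<Delta> K {}"
proof -
  have "no_descents_in W \<phi> \<Phi> \<Delta> K \<subseteq> carrier W"
    by (auto simp: no_descents_in_def)
  then show ?thesis
    using assms by (simp add: x_elt_def mu_def subset_class_empty sum.If_cases Int_absorb1)
qed

lemma sum_e_elt:
  assumes "group W" "finite (carrier W)" "coxeter_realization W S V \<phi> \<Phi> \<Delta>" "finite \<Delta>"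
    and "\<Lambda> \<in> subset_classes W \<phi> \<Delta>"
  shows "(\<Sum>w\<in>carrier W. e_elt W \<phi> \<Phi> \<Delta> \<Lambda> w) = (if \<Lambda> = {{}} then 1 else 0)"
proof -
  obtain J\<^sub>0 where J\<^sub>0: "J\<^sub>0 \<subseteq> \<Delta>" "\<Lambda> = subset_class W \<phi> \<Delta> J\<^sub>0"
    using assms(5) by (auto simp: subset_classes_def subset_class_def elim: quotientE)
  then have sub: "\<Lambda> \<subseteq> Pow \<Delta>"
    by (auto simp: subset_class_def subset_conj_def)
  \<comment> \<open>Only the empty set has empty image, so no other class contains
    \<open>{}\<close>.\<close>
  have "J\<^sub>0 = {}" if "{} \<in> \<Lambda>"
    using that J\<^sub>0 by (auto simp: subset_class_def subset_conj_def)
  then have empty: "{} \<in> \<Lambda> \<longleftrightarrow> \<Lambda> = {{}}"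
    using J\<^sub>0(2) subset_class_empty[OF assms(1), of \<phi> \<Delta>] by auto
  have tri: "\<not> K \<subseteq> J \<Longrightarrow> mu W \<phi> \<Phi> \<Delta> J K = 0" for J K
    by (simp add: mu_def)
  have diag: "J \<in> Pow \<Delta> \<Longrightarrow> mu W \<phi> \<Phi> \<Delta> J J \<noteq> 0" for J
    using mu_diagonal_nonzero[OF assms(1-4)] by simp
  have finP: "finite (Pow \<Delta>)" using assms(4) by simp
  have beta_mu: "(\<Sum>K\<in>Pow \<Delta>. beta W \<phi> \<Phi> \<Delta> J K * mu W \<phi> \<Phi> \<Delta> K L) = (if J = L then 1 else 0)"
    if "J \<in> Pow \<Delta>" "L \<in> Pow \<Delta>" for J L
    unfolding beta_def by (rule matrix_inv_on_triangular(1)[OF finP tri diag that])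
  have beta_tri: "beta W \<phi> \<Phi> \<Delta> J K = 0" if "\<not> K \<subseteq> J" for J K
    unfolding beta_def by (rule matrix_inv_on_triangular(2)[OF finP tri diag that])
  have row: "(\<Sum>w\<in>carrier W. \<Sum>K\<in>Pow J. beta W \<phi> \<Phi> \<Delta> J K * x_elt W \<phi> \<Phi> \<Delta> K w)
      = (if J = {} then 1 else 0)" if "J \<in> \<Lambda>" for J
  proof -
    have J: "J \<in> Pow \<Delta>" using that sub by auto
    have "(\<Sum>w\<in>carrier W. \<Sum>K\<in>Pow J. beta W \<phi> \<Phi> \<Delta> J K * x_elt W \<phi> \<Phi> \<Delta> K w)
        = (\<Sum>K\<in>Pow J. beta W \<phi> \<Phi> \<Delta> J K * mu W \<phi> \<Phi> \<Delta> K {})"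
      using assms(1,2) by (subst sum.swap) (simp add: sum_distrib_left[symmetric] sum_x_elt)
    \<comment> \<open>Triangularity of \<open>beta\<close> extends the sum to the full index set,
      where it becomes an entry of the product with \<open>mu\<close>.\<close>
    also have "\<dots> = (\<Sum>K\<in>Pow \<Delta>. beta W \<phi> \<Phi> \<Delta> J K * mu W \<phi> \<Phi> \<Delta> K {})"
      using J assms(4) beta_tri by (intro sum.mono_neutral_left) auto
    also have "\<dots> = (if J = {} then 1 else 0)"
      using beta_mu[OF J, of "{}"] by simp
    finally show ?thesis .
  qed
  have "(\<Sum>w\<in>carrier W. e_elt W \<phi> \<Phi> \<Delta> \<Lambda> w)
      = 1 / real (card \<Lambda>) * (\<Sum>J\<in>\<Lambda>. if J = {} then 1 else 0)"
    unfolding e_elt_def sum_distrib_left[symmetric]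
    by (subst sum.swap) (simp add: row)
  also have "\<dots> = (if \<Lambda> = {{}} then 1 else 0)"
    using empty finite_subset[OF sub] assms(4) by auto
  finally show ?thesis .
qed

theorem proposition1:
  fixes W :: "('g, 'c) monoid_scheme" and S :: "'g set"
    and V \<Phi> \<Delta> :: "'v::real_inner set" and \<phi> :: "'g \<Rightarrow> 'v \<Rightarrow> 'v" and x :: real
  assumes "coxeter_system W S" and "finite (carrier W)"
    and "coxeter_realization W S V \<phi> \<Phi> \<Delta>"
    and "x \<noteq> 0"
  shows "signed_probability_measure (carrier W) (M_elt W \<phi> \<Phi> \<Delta> x)"
proof -
  have grp: "group W"
    using assms(1) by (simp add: coxeter_system_def)
  have fin: "finite \<Delta>"
    using assms(3) by (auto simp: coxeter_realization_def root_system_def root_base_def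
        intro: finite_subset)
  let ?C = "subset_classes W \<phi> \<Delta>"
  have "?C \<subseteq> Pow (Pow \<Delta>)"
    by (auto simp: subset_classes_def subset_conj_def quotient_def)
  then have finC: "finite ?C"
    by (rule finite_subset) (simp add: fin)
  have inC: "{{}} \<in> ?C"
    using subset_class_empty[OF grp, of \<phi> \<Delta>]
    by (auto simp: subset_classes_def subset_class_def quotient_def)
  have "(\<Sum>w\<in>carrier W. M_elt W \<phi> \<Phi> \<Delta> x w)
      = (\<Sum>\<Lambda>\<in>?C. (\<Sum>w\<in>carrier W. e_elt W \<phi> \<Phi> \<Delta> \<Lambda> w) / x ^ class_rank \<Lambda>)"
    unfolding M_elt_def by (subst sum.swap) (simp add: sum_divide_distrib)
  also have "\<dots> = (\<Sum>\<Lambda>\<in>?C. if \<Lambda> = {{}} then 1 / x ^ class_rank \<Lambda> else 0)"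
    by (rule sum.cong) (simp_all add: sum_e_elt[OF grp assms(2,3) fin])
  also have "\<dots> = 1"
    \<comment> \<open>The surviving class has rank 0, so its weight is
      \<open>1 / x ^ 0 = 1\<close>.\<close>
    using finC inC by (simp add: class_rank_def)
  finally show ?thesis
    by (simp add: signed_probability_measure_def)
qed

end
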